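(* Let $k\ge 1$ be an integer and $n$ a positive integer. (1) If $G$ is an $(n-k-1)$-regular graph on $n$ vertices whose complement is planar, then $\mathrm{box}(G)\ge n/8$. (2) If $G$ is a graph on $n$ vertices whose complement is a $k$-regular graph containing no cycle $C_4$ as a subgraph, then $\mathrm{box}(G)\ge n/4$. (3) For $n\ge 3$, the complement $\overline{C_n}$ of the cycle on $n$ vertices satisfies $\mathrm{box}(\overline{C_n})\ge n/3$.
   Context: Graphs are finite, simple and undirected. The boxicity $\mathrm{box}(G)$ is the minimum $k$ such that there are interval graphs $I_1,\dots,I_k$ on $V(G)$ with $E(G)=E(I_1)\cap\cdots\cap E(I_k)$.
   Formalization: Part (3) is stated for all n ≥ 3 except n = 4, because the complement of C_4 is two disjoint edges, an interval graph of boxicity 1 < 4/3, so the printed bound fails there. *)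

theory Defs
  imports "HOL-Analysis.Analysis"
begin

record 'a ugraph =
  verts :: "'a set"
  edges :: "'a set set"

definition all_edges :: "'a set \<Rightarrow> 'a set set" where
  "all_edges V = {e. e \<subseteq> V \<and> card e = 2}"

definition simple_graph :: "'a ugraph \<Rightarrow> bool" where
  "simple_graph G \<longleftrightarrow> finite (verts G) \<and> edges G \<subseteq> all_edges (verts G)"

definition graph_complement :: "'a ugraph \<Rightarrow> 'a ugraph" where
  "graph_complement G = \<lparr>verts = verts G, edges = all_edges (verts G) - edges G\<rparr>"

definition vdegree :: "'a ugraph \<Rightarrow> 'a \<Rightarrow> nat" where
  "vdegree G v = card {e \<in> edges G. v \<in> e}"

definition regular_graph :: "nat \<Rightarrow> 'a ugraph \<Rightarrow> bool" where
  "regular_graph d G \<longleftrightarrow> (\<forall>v \<in> verts G. vdegree G v = d)"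

text \<open>Subgraph containment up to isomorphism; the copy need not be induced.\<close>

definition contains_subgraph :: "'a ugraph \<Rightarrow> 'b ugraph \<Rightarrow> bool" where
  "contains_subgraph G H \<longleftrightarrow>
     (\<exists>f. inj_on f (verts H) \<and> f ` verts H \<subseteq> verts G \<and> (\<forall>e \<in> edges H. f ` e \<in> edges G))"

text \<open>This is the cycle on \<open>n\<close> vertices only for \<open>n \<ge> 3\<close>.\<close>

definition cycle_graph :: "nat \<Rightarrow> nat ugraph" where
  "cycle_graph n = \<lparr>verts = {0..<n}, edges = {{i, (i + 1) mod n} | i. i < n}\<rparr>"

text \<open>A planar graph has a drawing in the plane (here the complex plane): vertices go to distinct
  points, and each edge goes to an arc (an injective path) that joins its endpoints and passes
  through no other vertex; arcs of distinct edges meet at most in common endpoints.\<close>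

definition planar :: "'a ugraph \<Rightarrow> bool" where
  "planar G \<longleftrightarrow>
     (\<exists>(p :: 'a \<Rightarrow> complex) (\<gamma> :: 'a set \<Rightarrow> real \<Rightarrow> complex).
        inj_on p (verts G) \<and>
        (\<forall>e \<in> edges G. arc (\<gamma> e) \<and> {pathstart (\<gamma> e), pathfinish (\<gamma> e)} = p ` e \<and>
           path_image (\<gamma> e) \<inter> p ` verts G = p ` e) \<and>
        (\<forall>e \<in> edges G. \<forall>f \<in> edges G. e \<noteq> f \<longrightarrow>
           path_image (\<gamma> e) \<inter> path_image (\<gamma> f) \<subseteq> p ` (e \<inter> f)))"

definition interval_graph :: "'a ugraph \<Rightarrow> bool" where
  "interval_graph G \<longleftrightarrow> simple_graph G \<and>
     (\<exists>l r :: 'a \<Rightarrow> real.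
        (\<forall>v \<in> verts G. l v \<le> r v) \<and>
        (\<forall>u \<in> verts G. \<forall>v \<in> verts G. u \<noteq> v \<longrightarrow>
           ({u, v} \<in> edges G \<longleftrightarrow> {l u..r u} \<inter> {l v..r v} \<noteq> {})))"

text \<open>The factor \<open>all_edges (verts G)\<close> matters only for \<open>k = 0\<close>, where it makes the empty
  intersection the edge set of the complete graph, so that complete graphs have boxicity 0.\<close>

definition box_representable :: "nat \<Rightarrow> 'a ugraph \<Rightarrow> bool" where
  "box_representable k G \<longleftrightarrow>
     (\<exists>I :: nat \<Rightarrow> 'a ugraph.
        (\<forall>i<k. interval_graph (I i) \<and> verts (I i) = verts G) \<and>
        edges G = all_edges (verts G) \<inter> (\<Inter>i<k. edges (I i)))"

definition boxicity :: "'a ugraph \<Rightarrow> nat" where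
  "boxicity G = (LEAST k. box_representable k G)"

text \<open>The minimum exists: delete from the complete graph one non-edge at a time.\<close>

lemma box_representable_exists:
  assumes "simple_graph G"
  shows "\<exists>k. box_representable k G"
proof -
  let ?V = "verts G"
  let ?N = "all_edges ?V - edges G"
  have "?N \<subseteq> Pow ?V"
    by (auto simp: all_edges_def)
  moreover have "finite (Pow ?V)"
    using assms by (simp add: simple_graph_def)
  ultimately have "finite ?N"
    by (rule finite_subset)
  then obtain es where es: "set es = ?N"
    using finite_list by blast
  define I :: "nat \<Rightarrow> 'a ugraph"
    where "I i = \<lparr>verts = ?V, edges = all_edges ?V - {es ! i}\<rparr>" for i
  have "interval_graph (I i)" if "i < length es" for i
  proof -
    have "es ! i \<in> all_edges ?V"
      using es nth_mem[OF that] by blast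
    then obtain a b where ab: "es ! i = {a, b}" "a \<noteq> b"
      by (auto simp: all_edges_def card_2_iff)
    define l r :: "'a \<Rightarrow> real"
      where "l = (\<lambda>v. if v = b then 2 else 0)" and "r = (\<lambda>v. if v = a then 0 else 2)"
    have "{u, v} \<in> edges (I i) \<longleftrightarrow> {l u..r u} \<inter> {l v..r v} \<noteq> {}"
      if "u \<in> ?V" "v \<in> ?V" "u \<noteq> v" for u v
      using that ab(2) unfolding I_def all_edges_def
      by (auto simp: ab(1) l_def r_def doubleton_eq_iff)
    moreover have "simple_graph (I i)"
      using assms by (auto simp: simple_graph_def I_def)
    moreover have "\<forall>v. l v \<le> r v"
      using ab(2) by (simp add: l_def r_def)
    ultimately show ?thesis
      unfolding interval_graph_def by (intro conjI exI[of _ l] exI[of _ r]) (auto simp: I_def)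
  qed
  moreover have "edges G = all_edges ?V \<inter> (\<Inter>i<length es. edges (I i))"
  proof -
    have "all_edges ?V \<inter> (\<Inter>i<length es. edges (I i)) = all_edges ?V - set es"
      by (auto simp: I_def set_conv_nth)
    then show ?thesis
      using es assms by (auto simp: simple_graph_def)
  qed
  ultimately have "box_representable (length es) G"
    unfolding box_representable_def by (intro exI[of _ I]) (auto simp: I_def)
  then show ?thesis ..
qed

text \<open>The complement of the 4-cycle consists of two disjoint edges and is an interval graph, so its
  boxicity is less than \<open>4/3\<close>. This is why \<open>n = 4\<close> has to be excluded from the bound \<open>n/3\<close> for
  complements of cycles.\<close>

lemma edges_complement_cycle_4: "edges (graph_complement (cycle_graph 4)) = {{0, 2}, {1, 3}}"
proof -
  have s: "{0..<4::nat} = {0, 1, 2, 3}" by auto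
  have "edges (cycle_graph 4) = (\<lambda>i. {i, (i + 1) mod 4}) ` {0..<4}"
    by (auto simp: cycle_graph_def)
  then have c: "edges (cycle_graph 4) = {{0, 1}, {1, 2}, {2, 3}, {3, 0}}"
    unfolding s by (simp add: numeral_2_eq_2 [symmetric])
  have a: "all_edges {0..<4::nat} = {{0, 1}, {0, 2}, {0, 3}, {1, 2}, {1, 3}, {2, 3}}" (is "_ = ?R")
  proof
    show "all_edges {0..<4::nat} \<subseteq> ?R"
    proof
      fix e :: "nat set"
      assume "e \<in> all_edges {0..<4}"
      then obtain x y where "e = {x, y}" "x \<noteq> y" "x \<in> {0, 1, 2, 3}" "y \<in> {0, 1, 2, 3}"
        unfolding all_edges_def s by (auto simp: card_2_iff)
      then show "e \<in> ?R"
        by (elim insertE emptyE) (simp_all add: doubleton_eq_iff)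
    qed
    show "?R \<subseteq> all_edges {0..<4::nat}"
      unfolding all_edges_def s by simp
  qed
  have "edges (graph_complement (cycle_graph 4)) = all_edges {0..<4} - edges (cycle_graph 4)"
    by (simp add: graph_complement_def cycle_graph_def)
  also have "\<dots> = {{0, 2}, {1, 3}}"
    unfolding a c by (simp add: insert_Diff_if doubleton_eq_iff)
  finally show ?thesis .
qed

lemma boxicity_complement_cycle_4: "boxicity (graph_complement (cycle_graph 4)) \<le> 1"
proof -
  let ?G = "graph_complement (cycle_graph 4)"
  have V: "verts ?G = {0, 1, 2, 3}"
    by (auto simp: graph_complement_def cycle_graph_def)
  have s: "simple_graph ?G"
    unfolding simple_graph_def V edges_complement_cycle_4 by (auto simp: all_edges_def)
  have "interval_graph ?G"
    unfolding interval_graph_def V edges_complement_cycle_4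
    using s by (intro conjI exI[of _ "\<lambda>v. real (v mod 2)"]) (auto simp: doubleton_eq_iff)
  then have "box_representable 1 ?G"
    unfolding box_representable_def using s
    by (intro exI[of _ "\<lambda>_. ?G"]) (auto simp: simple_graph_def)
  then show ?thesis unfolding boxicity_def by (rule Least_le)
qed

end

theory Submission
  imports Defs
begin

text \<open>Let \<open>H\<close> be the complement of \<open>G\<close>. If \<open>G\<close> is an intersection of \<open>b\<close> interval graphs \<open>I\<close>, then the
  non-edges of these \<open>I\<close> cover the edges of \<open>H\<close>, and there are \<open>n k / 2\<close> of those. Let \<open>j\<close> be maximal such
  that the \<open>j\<close> intervals of \<open>I\<close> that end first all lie to the left of the \<open>j\<close> intervals that start
  last. Every non-edge of \<open>I\<close> then meets one of these \<open>2 j\<close> vertices, which form a \<open>K\<^sub>j\<^sub>,\<^sub>j\<close> in \<open>H\<close>, so \<open>I\<close> has at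
  most \<open>2 j k - j\<^sup>2\<close> non-edges. If \<open>H\<close> has no \<open>C\<^sub>4 = K\<^sub>2\<^sub>,\<^sub>2\<close>, then \<open>j \<le> 1\<close> and there are at most \<open>2 k - 1\<close> of them.
  If \<open>H\<close> is planar, then it has no \<open>K\<^sub>3\<^sub>,\<^sub>3\<close>, so \<open>j \<le> 2\<close> and there are at most \<open>4 k\<close> of them.

  Two vertices on one side of a plane \<open>K\<^sub>3\<^sub>,\<^sub>3\<close> span a theta curve of three arcs. The third vertex
  lies in one of its faces and is joined to an inner point of every arc, but each
  face is bounded by only two of the arcs.\<close>

subsection \<open>Nonplanarity of the utility graph\<close>

text \<open>By \<open>ins\<close> the third arc cuts the inside of the first two into two faces,
  each bounded by only two of the arcs. A connected set off the theta curve lies on the same side of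
  a pair of arcs as any of its closure points off that pair. So \<open>K\<close> sits in one of the
  two faces and drags \<open>y1\<close> or \<open>y2\<close>, which lie on the outer curve, into its
  inside.\<close>

lemma theta_curve_inside:
  fixes c1 c2 c3 :: "real \<Rightarrow> complex"
  assumes arcs: "arc c1" "arc c2" "arc c3"
    and start: "pathstart c1 = a" "pathstart c2 = a" "pathstart c3 = a"
    and finish: "pathfinish c1 = b" "pathfinish c2 = b" "pathfinish c3 = b"
    and meet: "path_image c1 \<inter> path_image c2 = {a, b}" "path_image c1 \<inter> path_image c3 = {a, b}"
      "path_image c2 \<inter> path_image c3 = {a, b}"
    and K: "connected K" "K \<inter> (path_image c1 \<union> path_image c2 \<union> path_image c3) = {}"
    and y: "y1 \<in> path_image c1 - {a, b}" "y2 \<in> path_image c2 - {a, b}" "y3 \<in> path_image c3 - {a, b}"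
    and cl: "{y1, y2, y3} \<subseteq> closure K"
    and ins: "y3 \<in> inside (path_image c1 \<union> path_image c2)"
  shows False
proof -
  let ?P1 = "path_image c1" and ?P2 = "path_image c2" and ?P3 = "path_image c3"
  have ab: "a \<noteq> b"
    using arc_distinct_ends[OF arcs(1)] start finish by auto
  have split: "inside (?P1 \<union> ?P3) \<union> inside (?P2 \<union> ?P3) \<union> (?P3 - {a, b}) = inside (?P1 \<union> ?P2)"
  proof (rule split_inside_simple_closed_curve[of c1 a b c2 c3])
    show "?P3 \<inter> inside (?P1 \<union> ?P2) \<noteq> {}" using ins y(3) by blast
  qed (use arcs start finish meet ab in \<open>auto intro: arc_imp_simple_path\<close>)
  have conn: "connected (insert x K)" if "x \<in> closure K" for x
    by (rule connected_intermediate_closure[OF K(1)]) (use that closure_subset in auto)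
  have same: "x \<in> inside S \<longleftrightarrow> z \<in> inside S"
    if "x \<in> closure K" "z \<in> K" "S \<inter> insert x K = {}" for x z S
    using inside_outside_intersect_connected[OF conn[OF that(1)], of S] that inside_Un_outside[of S]
    by blast
  obtain z where z: "z \<in> K" using cl by fastforce
  \<comment> \<open>Each of the three points lies off the pair formed by the other two arcs, so
    \<open>same\<close> compares it with \<open>z\<close> there.\<close>
  have "y1 \<notin> ?P2 \<union> ?P3" "y2 \<notin> ?P1 \<union> ?P3" "y3 \<notin> ?P1 \<union> ?P2"
    using y meet by blast+
  then have *: "y3 \<in> inside (?P1 \<union> ?P2) \<longleftrightarrow> z \<in> inside (?P1 \<union> ?P2)"
    "y2 \<in> inside (?P1 \<union> ?P3) \<longleftrightarrow> z \<in> inside (?P1 \<union> ?P3)"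
    "y1 \<in> inside (?P2 \<union> ?P3) \<longleftrightarrow> z \<in> inside (?P2 \<union> ?P3)"
    using same[OF _ z] cl K(2) by (intro same[OF _ z]; blast)+
  then have "z \<in> inside (?P1 \<union> ?P3) \<union> inside (?P2 \<union> ?P3)"
    using ins split z K(2) by blast
  then have "y1 \<in> inside (?P1 \<union> ?P2) \<or> y2 \<in> inside (?P1 \<union> ?P2)"
    using * split by blast
  then show False
    using y(1,2) inside_no_overlap by blast
qed

text \<open>Inversion sends points near \<open>w\<close> to points of large norm. If the image of
  \<open>y\<close> were outside, it would be joined there to such points; pulling the connection
  back joins \<open>y\<close> to points close to \<open>w\<close> without meeting \<open>S\<close>,
  although \<open>w\<close> is inside.\<close>

lemma inversion_outside_inside:
  fixes S :: "complex set"
  assumes S: "bounded S" "closed S" and w: "w \<in> inside S" and y: "y \<in> outside S"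
  shows "inverse (y - w) \<in> inside ((\<lambda>x. inverse (x - w)) ` S)"
proof (rule ccontr)
  let ?f = "\<lambda>x. inverse (x - w)" and ?g = "\<lambda>x. w + inverse x"
  have wS: "w \<notin> S" and yS: "y \<notin> S" and yw: "y \<noteq> w"
    using w y inside_no_overlap[of S] outside_no_overlap[of S] inside_Int_outside[of S] by blast+
  have "compact (?f ` S)"
    using S wS by (intro compact_continuous_image continuous_intros)
      (auto simp: compact_eq_bounded_closed)
  then have bd: "bounded (?f ` S)" and clo: "closed (?f ` S)"
    by (auto simp: compact_eq_bounded_closed)
  assume "?f y \<notin> inside (?f ` S)"
  moreover have "?f y \<notin> ?f ` S" using yS by auto
  ultimately have fy: "?f y \<in> outside (?f ` S)"
    using inside_Un_outside[of "?f ` S"] by blast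
  \<comment> \<open>The point 0 has no preimage under the inversion. Deleting it from an open
    connected plane set keeps the set connected.\<close>
  define D where "D = outside (?f ` S) - {0}"
  have "connected D"
    unfolding D_def using bd clo by (intro connected_open_delete open_outside connected_outside) auto
  then have conn: "connected (?g ` D)"
    by (intro connected_continuous_image continuous_intros) (auto simp: D_def)
  have "?g (?f y) \<in> ?g ` D" using fy yw by (intro imageI) (auto simp: D_def)
  then have yD: "y \<in> ?g ` D" by simp
  obtain e where e: "e > 0" "ball w e \<subseteq> inside S"
    using open_inside[OF S(2)] w open_contains_ball by blast
  \<comment> \<open>A norm above \<open>1 / e\<close> places \<open>?g x\<close> within
    \<open>e\<close> of \<open>w\<close>, that is, inside \<open>S\<close>.\<close>
  obtain x where x: "x \<in> outside (?f ` S)" "norm x > 1 / e"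
    using unbounded_outside[OF bd] by (meson boundedI not_le)
  have x0: "x \<noteq> 0" using x(2) e(1) by (auto simp: less_le_not_le)
  have "norm (inverse x) < e"
    using x(2) e(1) x0 by (simp add: norm_inverse inverse_eq_divide norm_divide divide_less_eq pos_less_divide_eq mult.commute)
  then have "?g x \<in> inside S" using e(2) by (auto simp: dist_norm)
  then have "S \<inter> ?g ` D \<noteq> {}"
    using inside_outside_intersect_connected[OF conn, of S] yD y x(1) x0 by (auto simp: D_def)
  then obtain d where d: "d \<in> D" "?g d \<in> S" by auto
  then have "?f (?g d) \<in> ?f ` S" by blast
  then have "d \<in> ?f ` S" by simp
  then show False using d(1) outside_no_overlap[of "?f ` S"] unfolding D_def by blast
qed

text \<open>Inversion at a point inside two of the arcs moves the third one inside.\<close>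

lemma theta_curve:
  fixes c1 c2 c3 :: "real \<Rightarrow> complex"
  assumes arcs: "arc c1" "arc c2" "arc c3"
    and start: "pathstart c1 = a" "pathstart c2 = a" "pathstart c3 = a"
    and finish: "pathfinish c1 = b" "pathfinish c2 = b" "pathfinish c3 = b"
    and meet: "path_image c1 \<inter> path_image c2 = {a, b}" "path_image c1 \<inter> path_image c3 = {a, b}"
      "path_image c2 \<inter> path_image c3 = {a, b}"
    and K: "connected K" "K \<inter> (path_image c1 \<union> path_image c2 \<union> path_image c3) = {}"
    and y: "y1 \<in> path_image c1 - {a, b}" "y2 \<in> path_image c2 - {a, b}" "y3 \<in> path_image c3 - {a, b}"
    and cl: "{y1, y2, y3} \<subseteq> closure K"
  shows False
proof (cases "y3 \<in> inside (path_image c1 \<union> path_image c2)")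
  case True
  then show ?thesis using theta_curve_inside assms by blast
next
  case False
  let ?P1 = "path_image c1" and ?P2 = "path_image c2" and ?P3 = "path_image c3"
  let ?C = "?P1 \<union> ?P2"
  \<comment> \<open>The first two arcs form a Jordan curve, whose nonempty inside supplies the
    centre \<open>w\<close> of the inversion.\<close>
  have "simple_path (c1 +++ reversepath c2)"
    using arcs start finish meet by (simp add: simple_path_join_loop_eq arc_reversepath)
  moreover have "path_image (c1 +++ reversepath c2) = ?C"
    using start finish by (simp add: path_image_join)
  ultimately have ne: "inside ?C \<noteq> {}"
    using Jordan_inside_outside[of "c1 +++ reversepath c2"] start finish by simp
  have y3: "y3 \<in> outside ?C"
    using False y meet inside_Un_outside[of ?C] by blast
  have out: "inside ?C \<inter> T = {}" if "connected T" "y3 \<in> T" "?C \<inter> T = {}" for T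
    using inside_outside_intersect_connected[OF that(1), of ?C] that y3 by blast
  \<comment> \<open>\<open>K\<close> and the third arc without its ends are both connected to
    \<open>y3\<close> off the curve, so they miss its inside. Hence \<open>w\<close> avoids
    everything that is to be inverted.\<close>
  have "connected (insert y3 K)"
    by (rule connected_intermediate_closure[OF K(1)]) (use cl closure_subset in auto)
  then have K_out: "inside ?C \<inter> K = {}"
    using out[of "insert y3 K"] K(2) y(3) meet by blast
  have "connected (?P3 - {a, b})"
    using connected_simple_path_endless[of c3] arcs start finish arc_imp_simple_path by auto
  then have "inside ?C \<inter> (?P3 - {a, b}) = {}"
    using out y(3) meet by blast
  moreover have "a \<in> ?C" "b \<in> ?C" using meet by blast+
  ultimately have P3_out: "inside ?C \<inter> ?P3 = {}"
    using inside_no_overlap by blast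
  obtain w where w: "w \<in> inside ?C" using ne by blast
  then have wn: "w \<notin> ?P1" "w \<notin> ?P2" "w \<notin> ?P3" "w \<notin> K"
    using K_out P3_out inside_no_overlap by blast+
  define f where "f x = inverse (x - w)" for x
  have inj: "inj f" by (auto simp: f_def inj_on_def)
  have cont: "continuous_on T f" if "w \<notin> T" for T
    unfolding f_def using that by (intro continuous_intros) auto
  have arc_f: "arc (f \<circ> c)" if "arc c" "w \<notin> path_image c" for c
    using that inj cont[OF that(2)] path_continuous_image[of c f] comp_inj_on[of c "{0..1}" f]
    by (auto simp: arc_def intro: inj_on_subset)
  have Int_f: "f ` A \<inter> f ` B = f ` (A \<inter> B)" for A B
    using image_Int[OF inj] by simp
  have cl_f: "f x \<in> closure (f ` K)" if "x \<in> closure K" "x \<noteq> w" for x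
  proof -
    have "isCont f x"
      unfolding f_def using that(2) by (intro continuous_intros) auto
    obtain s where "\<forall>n. s n \<in> K" "s \<longlonglongrightarrow> x"
      using \<open>x \<in> closure K\<close> closure_sequential by blast
    then show ?thesis
      unfolding closure_sequential using isCont_tendsto_compose[OF \<open>isCont f x\<close>]
      by (intro exI[of _ "f \<circ> s"]) (auto simp: o_def)
  qed
  show False
  proof (rule theta_curve_inside[of "f \<circ> c1" "f \<circ> c2" "f \<circ> c3" "f a" "f b" "f ` K" "f y1" "f y2" "f y3"])
    show "connected (f ` K)" using cont K wn by (intro connected_continuous_image) auto
    have "bounded ?C" "closed ?C"
      using arcs by (auto intro: bounded_arc_image closed_arc_image)
    then show "f y3 \<in> inside (path_image (f \<circ> c1) \<union> path_image (f \<circ> c2))"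
      using inversion_outside_inside[OF _ _ w y3]
      unfolding f_def path_image_compose by (simp add: image_Un)
    show "{f y1, f y2, f y3} \<subseteq> closure (f ` K)"
      using cl cl_f y wn by auto
    show "f ` K \<inter> (path_image (f \<circ> c1) \<union> path_image (f \<circ> c2) \<union> path_image (f \<circ> c3)) = {}"
      using K(2) unfolding path_image_compose image_Un[symmetric] Int_f by simp
  qed (use arcs arc_f wn start finish meet y inj in
      \<open>auto simp: pathstart_compose pathfinish_compose path_image_compose Int_f inj_eq\<close>)
qed

text \<open>The remaining set is the image of \<open>{0..<1}\<close>, which is connected and has 1
  in its closure. Arcs cut off in this way at a vertex build the set \<open>K\<close> of the theta
  curve lemma.\<close>

lemma arc_without_finish:
  fixes g :: "real \<Rightarrow> 'a::t2_space"
  assumes "arc g"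
  shows "connected (path_image g - {pathfinish g})"
    and "pathfinish g \<in> closure (path_image g - {pathfinish g})"
proof -
  have cont: "continuous_on {0..1} g" and inj: "inj_on g {0..1}"
    using assms by (auto simp: arc_def path_def)
  have *: "path_image g - {pathfinish g} = g ` {0..<1}"
  proof -
    have "{0..1::real} = insert 1 {0..<1}" by auto
    then have "path_image g = insert (g 1) (g ` {0..<1})" by (simp add: path_image_def)
    moreover have "g 1 \<notin> g ` {0..<1}" using inj_on_image_mem_iff[OF inj, of 1 "{0..<1}"] by (simp add: subset_iff)
    ultimately show ?thesis by (simp add: pathfinish_def)
  qed
  show "connected (path_image g - {pathfinish g})"
    unfolding * by (intro connected_continuous_image continuous_on_subset[OF cont]) auto
  have "g ` closure {0..<1} \<subseteq> closure (g ` {0..<1})"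
    using cont by (intro image_closure_subset closure_subset) auto
  then show "pathfinish g \<in> closure (path_image g - {pathfinish g})"
    unfolding * by (auto simp: pathfinish_def)
qed

text \<open>Paths from \<open>a\<close> to \<open>b\<close> through the three vertices of
  \<open>W\<close> form a theta curve. The third vertex \<open>z\<close> of \<open>U\<close>, with
  its arcs towards \<open>W\<close> cut off at their ends, is a connected set whose closure reaches
  all three paths at inner points.\<close>

lemma planar_no_K33:
  assumes "planar H" and V: "U \<subseteq> verts H" "W \<subseteq> verts H" and card: "card U = 3" "card W = 3"
    and disj: "U \<inter> W = {}" and E: "\<And>u w. u \<in> U \<Longrightarrow> w \<in> W \<Longrightarrow> {u, w} \<in> edges H"
  shows False
proof -
  obtain p :: "_ \<Rightarrow> complex" and \<gamma> :: "_ \<Rightarrow> real \<Rightarrow> complex" where p: "inj_on p (verts H)"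
    and \<gamma>: "\<forall>e\<in>edges H. arc (\<gamma> e) \<and> {pathstart (\<gamma> e), pathfinish (\<gamma> e)} = p ` e \<and>
      path_image (\<gamma> e) \<inter> p ` verts H = p ` e"
    and cross: "\<forall>e\<in>edges H. \<forall>f\<in>edges H. e \<noteq> f \<longrightarrow>
      path_image (\<gamma> e) \<inter> path_image (\<gamma> f) \<subseteq> p ` (e \<inter> f)"
    using assms(1) unfolding planar_def by (elim exE conjE) (rule that; assumption)
  have pU: "p u = p u' \<longleftrightarrow> u = u'" if "u \<in> U \<union> W" "u' \<in> U \<union> W" for u u'
    using that V inj_onD[OF p] by blast
  \<comment> \<open>The drawing does not fix the direction of an arc; \<open>g u w\<close> is made
    to run from \<open>U\<close> to \<open>W\<close>.\<close>
  have "\<exists>h. arc h \<and> pathstart h = p u \<and> pathfinish h = p w \<and> path_image h = path_image (\<gamma> {u, w})"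
    if "u \<in> U" "w \<in> W" for u w
    using bspec[OF \<gamma> E[OF that]]
    by (intro exI[of _ "if pathstart (\<gamma> {u, w}) = p u then \<gamma> {u, w} else reversepath (\<gamma> {u, w})"])
      (auto simp: doubleton_eq_iff arc_reversepath)
  then obtain g where g: "\<And>u w. u \<in> U \<Longrightarrow> w \<in> W \<Longrightarrow> arc (g u w) \<and> pathstart (g u w) = p u \<and>
      pathfinish (g u w) = p w \<and> path_image (g u w) = path_image (\<gamma> {u, w})"
    by metis
  have gx: "path_image (g u w) \<inter> path_image (g u' w') = p ` ({u, w} \<inter> {u', w'})"
    if "u \<in> U" "w \<in> W" "u' \<in> U" "w' \<in> W" "u \<noteq> u' \<or> w \<noteq> w'" for u w u' w'
  proof
    have "{u, w} \<noteq> {u', w'}" using that disj by (auto simp: doubleton_eq_iff)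
    then show "path_image (g u w) \<inter> path_image (g u' w') \<subseteq> p ` ({u, w} \<inter> {u', w'})"
      using cross E g that by metis
    have "p ` {a, b} \<subseteq> path_image (g a b)" if "a \<in> U" "b \<in> W" for a b
      using g[OF that] pathstart_in_path_image[of "g a b"] pathfinish_in_path_image[of "g a b"]
      by auto
    then show "p ` ({u, w} \<inter> {u', w'}) \<subseteq> path_image (g u w) \<inter> path_image (g u' w')"
      using that by blast
  qed
  obtain a b z where U: "U = {a, b, z}" "a \<noteq> b" "a \<noteq> z" "b \<noteq> z"
    using card(1) by (auto simp: card_3_iff)
  obtain y1 y2 y3 where W: "W = {y1, y2, y3}" "y1 \<noteq> y2" "y1 \<noteq> y3" "y2 \<noteq> y3"
    using card(2) by (auto simp: card_3_iff)
  have inU: "a \<in> U" "b \<in> U" "z \<in> U" and inW: "y1 \<in> W" "y2 \<in> W" "y3 \<in> W"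
    using U W by auto
  have neq: "u \<noteq> w" if "u \<in> U" "w \<in> W" for u w using that disj by auto
  define c where "c y = g a y +++ reversepath (g b y)" for y
  \<comment> \<open>Removing \<open>p y\<close> keeps \<open>B y\<close> off the theta curve, while
    \<open>p y\<close> remains in its closure.\<close>
  define B where "B y = path_image (g z y) - {p y}" for y
  have c: "arc (c y)" "pathstart (c y) = p a" "pathfinish (c y) = p b"
    "path_image (c y) = path_image (g a y) \<union> path_image (g b y)" if "y \<in> W" for y
  proof -
    note ga = g[OF inU(1) that] and gb = g[OF inU(2) that]
    have "path_image (g a y) \<inter> path_image (g b y) = {p y}"
      using gx[OF inU(1) that inU(2) that] U(2) neq[OF inU(1) that] by auto
    then show "arc (c y)" unfolding c_def
      using ga gb by (intro arc_join) (auto simp: arc_reversepath)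
    show "pathstart (c y) = p a" "pathfinish (c y) = p b"
      "path_image (c y) = path_image (g a y) \<union> path_image (g b y)"
      using ga gb by (auto simp: c_def path_image_join)
  qed
  have meet: "path_image (c y) \<inter> path_image (c y') = {p a, p b}"
    if "y \<in> W" "y' \<in> W" "y \<noteq> y'" for y y'
    using that c(4) gx[OF inU(1) that(1) inU(1) that(2)] gx[OF inU(1) that(1) inU(2) that(2)]
      gx[OF inU(2) that(1) inU(1) that(2)] gx[OF inU(2) that(1) inU(2) that(2)] U(2) neq inU
    by (simp add: Int_Un_distrib Int_Un_distrib2 Int_insert_left Int_insert_right)
      (auto simp: insert_commute)
  have yc: "p y \<in> path_image (c y) - {p a, p b}" if "y \<in> W" for y
    using c(4)[OF that] g[OF inU(1) that] pathfinish_in_path_image[of "g a y"] pU inU that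
      neq[OF inU(1) that] neq[OF inU(2) that]
    by auto
  have zB: "p z \<in> B y" if "y \<in> W" for y
    using g[OF inU(3) that] pathstart_in_path_image[of "g z y"] pU inU that neq[OF inU(3) that]
    by (auto simp: B_def)
  have B: "connected (B y)" "p y \<in> closure (B y)" if "y \<in> W" for y
    using arc_without_finish[of "g z y"] g[OF inU(3) that] by (auto simp: B_def)
  have BC: "B y \<inter> path_image (c y') = {}" if "y \<in> W" "y' \<in> W" for y y'
    using c(4)[OF that(2)] gx[OF inU(3) that(1) inU(1) that(2)] gx[OF inU(3) that(1) inU(2) that(2)]
      U neq[OF inU(1) that(1)] neq[OF inU(2) that(1)] neq[OF inU(3) that(2)] that
    by (auto simp: B_def)
  show False
  proof (rule theta_curve[of "c y1" "c y2" "c y3" "p a" "p b" "\<Union>y\<in>W. B y" "p y1" "p y2" "p y3"])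
    \<comment> \<open>All \<open>B y\<close> share the point \<open>p z\<close>.\<close>
    show "connected (\<Union>y\<in>W. B y)"
      using zB B(1) by (intro connected_Union) auto
    show "(\<Union>y\<in>W. B y) \<inter> (path_image (c y1) \<union> path_image (c y2) \<union> path_image (c y3)) = {}"
      using BC inW by blast
    have "closure (B y) \<subseteq> closure (\<Union>y\<in>W. B y)" if "y \<in> W" for y
      using that by (intro closure_mono) auto
    then show "{p y1, p y2, p y3} \<subseteq> closure (\<Union>y\<in>W. B y)"
      using B(2) inW by blast
  qed (rule c(1-3) meet yc inW W)+
qed

subsection \<open>Non-edges of interval graphs\<close>

text \<open>This is \<open>K\<^sub>m\<^sub>,\<^sub>m\<close> as a subgraph, not necessarily induced.
  It is given by its sides because both the counting and the planarity argument work with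
  them.\<close>

definition has_biclique :: "nat \<Rightarrow> 'a ugraph \<Rightarrow> bool" where
  "has_biclique m G \<longleftrightarrow>
     (\<exists>U W. U \<subseteq> verts G \<and> W \<subseteq> verts G \<and> U \<inter> W = {} \<and> card U = m \<and> card W = m \<and>
        (\<forall>u\<in>U. \<forall>w\<in>W. {u, w} \<in> edges G))"

lemma has_biclique_mono:
  assumes "U \<subseteq> verts G" "W \<subseteq> verts G" "U \<inter> W = {}" "m \<le> card U" "m \<le> card W"
    and "\<forall>u\<in>U. \<forall>w\<in>W. {u, w} \<in> edges G"
  shows "has_biclique m G"
proof -
  obtain U' W' where sub: "U' \<subseteq> U" "W' \<subseteq> W" and card: "card U' = m" "card W' = m"
    using obtain_subset_with_card_n[OF assms(4)] obtain_subset_with_card_n[OF assms(5)] by metis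
  have "U' \<inter> W' = {}" "\<forall>u\<in>U'. \<forall>w\<in>W'. {u, w} \<in> edges G"
    using sub assms(3,6) by blast+
  moreover have "U' \<subseteq> verts G" "W' \<subseteq> verts G"
    using sub assms(1,2) by simp_all
  ultimately show ?thesis
    unfolding has_biclique_def using card by (intro exI[of _ U'] exI[of _ W'] conjI)
qed

lemma finite_all_edges: "finite V \<Longrightarrow> finite (all_edges V)"
  by (rule finite_subset[of _ "Pow V"]) (auto simp: all_edges_def)

lemma pair_in_all_edges: "{u, v} \<in> all_edges V \<longleftrightarrow> u \<in> V \<and> v \<in> V \<and> u \<noteq> v"
  by (auto simp: all_edges_def card_2_iff doubleton_eq_iff)

lemma all_edgesE:
  assumes "e \<in> all_edges V"
  obtains u v where "e = {u, v}" "u \<in> V" "v \<in> V" "u \<noteq> v"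
  using assms by (auto simp: all_edges_def card_2_iff)

text \<open>\<open>U\<close> consists of the intervals ending first and \<open>W\<close> of those starting last, with \<open>card U\<close> maximal. A
  pair of disjoint intervals avoiding \<open>U \<union> W\<close> would allow to enlarge both sets.\<close>

lemma interval_graph_nonedges_cover:
  assumes I: "interval_graph I"
  obtains U W where "U \<subseteq> verts I" "W \<subseteq> verts I" "U \<inter> W = {}" "card W = card U"
    "\<And>u w. u \<in> U \<Longrightarrow> w \<in> W \<Longrightarrow> {u, w} \<in> all_edges (verts I) - edges I"
    "\<And>e. e \<in> all_edges (verts I) - edges I \<Longrightarrow> e \<inter> (U \<union> W) \<noteq> {}"
proof -
  let ?V = "verts I" and ?J = "all_edges (verts I) - edges I"
  have fin: "finite ?V" using I by (auto simp: interval_graph_def simple_graph_def)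
  obtain l r :: "'a \<Rightarrow> real" where lr: "\<forall>v\<in>?V. l v \<le> r v"
    and edge: "\<forall>u\<in>?V. \<forall>v\<in>?V. u \<noteq> v \<longrightarrow>
      ({u, v} \<in> edges I \<longleftrightarrow> {l u..r u} \<inter> {l v..r v} \<noteq> {})"
    using I unfolding interval_graph_def by (elim exE conjE) (rule that)
  have J: "{u, v} \<in> ?J \<longleftrightarrow> r u < l v \<or> r v < l u" if "u \<in> ?V" "v \<in> ?V" "u \<noteq> v" for u v
    using edge[rule_format, OF that] bspec[OF lr that(1)] bspec[OF lr that(2)] that
    by (auto simp: pair_in_all_edges Int_atLeastAtMost)
  \<comment> \<open>\<open>U\<close> is an initial segment for right ends and \<open>W\<close> a
    final segment for left ends; the weak inequalities admit ties.\<close>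
  define good where "good U W \<longleftrightarrow> U \<subseteq> ?V \<and> W \<subseteq> ?V \<and> card W = card U \<and>
      (\<forall>u\<in>U. \<forall>v\<in>?V - U. r u \<le> r v) \<and> (\<forall>w\<in>W. \<forall>v\<in>?V - W. l v \<le> l w) \<and>
      (\<forall>u\<in>U. \<forall>w\<in>W. r u < l w)" for U W
  \<comment> \<open>The empty pair is good and all sizes stay strictly below
    \<open>Suc (card ?V)\<close>, so a largest good pair exists.\<close>
  have "\<exists>X. (case X of (U, W) \<Rightarrow> good U W) \<and>
      (\<forall>Y. (case Y of (U, W) \<Rightarrow> good U W) \<longrightarrow> card (fst Y) \<le> card (fst X))"
    by (rule ex_has_greatest_nat[of _ "({}, {})" _ "Suc (card ?V)"])
      (auto simp: good_def less_Suc_eq_le intro: card_mono fin)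
  then obtain U W where UW: "good U W" and max: "\<And>U' W'. good U' W' \<Longrightarrow> card U' \<le> card U"
    by (auto simp: split_paired_Ex split_paired_All)
  have UV: "U \<subseteq> ?V" and WV: "W \<subseteq> ?V" and cardW: "card W = card U"
    and first: "\<And>u v. u \<in> U \<Longrightarrow> v \<in> ?V - U \<Longrightarrow> r u \<le> r v"
    and last: "\<And>w v. w \<in> W \<Longrightarrow> v \<in> ?V - W \<Longrightarrow> l v \<le> l w"
    and left: "\<And>u w. u \<in> U \<Longrightarrow> w \<in> W \<Longrightarrow> r u < l w"
    using UW unfolding good_def by simp_all
  have finUW: "finite U" "finite W" using finite_subset[OF UV fin] finite_subset[OF WV fin] by simp_all
  have disj: "U \<inter> W = {}"
  proof -
    have False if "x \<in> U" "x \<in> W" for x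
      using left[OF that] bspec[OF lr, of x] UV that(1) by auto
    then show ?thesis by blast
  qed
  show ?thesis
  proof (rule that[OF UV WV disj cardW])
    show "{u, w} \<in> ?J" if "u \<in> U" "w \<in> W" for u w
    proof -
      have "u \<in> ?V" "w \<in> ?V" "u \<noteq> w" using that UV WV disj by auto
      then show ?thesis using J left[OF that] by blast
    qed
    fix e assume e: "e \<in> ?J"
    show "e \<inter> (U \<union> W) \<noteq> {}"
    proof
      assume none: "e \<inter> (U \<union> W) = {}"
      obtain a b where ab: "e = {a, b}" "a \<in> ?V" "b \<in> ?V" "a \<noteq> b"
        using e all_edgesE by (metis DiffD1)
      then have "r a < l b \<or> r b < l a" using J e by simp
      then obtain x y where xy: "e = {x, y}" "x \<in> ?V" "y \<in> ?V" "r x < l y"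
        using ab insert_commute by metis
      \<comment> \<open>A first interval to end outside \<open>U\<close> and a last one to start
        outside \<open>W\<close> are the candidates for the enlargement.\<close>
      define u where "u = arg_min_on r (?V - U)"
      define w where "w = arg_min_on (\<lambda>v. - l v) (?V - W)"
      have xn: "x \<in> ?V - U" and yn: "y \<in> ?V - W" using xy none by auto
      have u: "u \<in> ?V - U"
        unfolding u_def using xn fin by (intro arg_min_if_finite(1)) auto
      have u_min: "r u \<le> r v" if "v \<in> ?V - U" for v
        unfolding u_def using that fin by (intro arg_min_least) auto
      have w: "w \<in> ?V - W"
        unfolding w_def using yn fin by (intro arg_min_if_finite(1)) auto
      have w_max: "l v \<le> l w" if "v \<in> ?V - W" for v
        using arg_min_least[of "?V - W" v "\<lambda>v. - l v"] that fin by (auto simp: w_def)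
      \<comment> \<open>Since \<open>x\<close> avoids \<open>U\<close> and \<open>y\<close> avoids
        \<open>W\<close>, \<open>r u \<le> r x < l y \<le> l w\<close>.\<close>
      have uw: "r u < l w" using xy(4) u_min[OF xn] w_max[OF yn] by linarith
      have 1: "r u < l w'" if "w' \<in> W" for w' using last[OF that w] uw by linarith
      have 2: "r u' < l w" if "u' \<in> U" for u' using first[OF that u] uw by linarith
      have "card (insert w W) = card (insert u U)" using finUW u w cardW by simp
      then have "good (insert u U) (insert w W)"
        unfolding good_def using UV WV u w first last left u_min w_max uw 1 2 by simp
      then show False using max[of "insert u U" "insert w W"] u finUW by simp
    qed
  qed
qed

text \<open>Inclusion-exclusion with \<open>j = card U\<close>: at most \<open>j * k\<close>
  non-edges meet each of \<open>U\<close> and \<open>W\<close>, and the \<open>j * j\<close> pairs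
  between them meet both. The square stands on the left to avoid subtraction of naturals.\<close>

lemma card_interval_graph_nonedges:
  assumes I: "interval_graph I" and H: "verts H = verts I" "edges H \<subseteq> all_edges (verts I)"
    and sub: "all_edges (verts I) - edges I \<subseteq> edges H"
    and deg: "\<And>v. v \<in> verts H \<Longrightarrow> vdegree H v \<le> k"
    and no: "\<not> has_biclique m H"
  obtains j where "j < m" "card (all_edges (verts I) - edges I) + j\<^sup>2 \<le> 2 * j * k"
proof -
  let ?J = "all_edges (verts I) - edges I"
  obtain U W where UW: "U \<subseteq> verts I" "W \<subseteq> verts I" "U \<inter> W = {}" "card W = card U"
    and bi: "\<And>u w. u \<in> U \<Longrightarrow> w \<in> W \<Longrightarrow> {u, w} \<in> ?J"
    and cover: "\<And>e. e \<in> ?J \<Longrightarrow> e \<inter> (U \<union> W) \<noteq> {}"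
    using interval_graph_nonedges_cover[OF I] by blast
  have fin: "finite (verts I)" using I by (auto simp: interval_graph_def simple_graph_def)
  then have finE: "finite (edges H)" "finite ?J"
    using finite_subset[OF H(2)] by (simp_all add: finite_all_edges)
  define meet where "meet X = {e \<in> ?J. e \<inter> X \<noteq> {}}" for X
  have finm: "finite (meet X)" for X by (rule finite_subset[OF _ finE(2)]) (auto simp: meet_def)
  have meet_le: "card (meet X) \<le> card X * k" if "X \<subseteq> verts I" for X
  proof -
    have finX: "finite X" using that fin by (rule finite_subset)
    have "meet X \<subseteq> (\<Union>v\<in>X. {e \<in> edges H. v \<in> e})" using sub by (auto simp: meet_def)
    then have "card (meet X) \<le> card (\<Union>v\<in>X. {e \<in> edges H. v \<in> e})"
      using finE finX by (intro card_mono) auto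
    also have "\<dots> \<le> (\<Sum>v\<in>X. vdegree H v)"
      unfolding vdegree_def using finX by (rule card_UN_le)
    also have "\<dots> \<le> card X * k"
      using sum_bounded_above[of X "vdegree H" k] deg H that by auto
    finally show ?thesis .
  qed
  \<comment> \<open>As \<open>U\<close> and \<open>W\<close> are disjoint, different ordered pairs
    give different edges.\<close>
  have "inj_on (\<lambda>(u, w). {u, w}) (U \<times> W)"
    using UW(3) by (auto simp: inj_on_def doubleton_eq_iff)
  then have "card ((\<lambda>(u, w). {u, w}) ` (U \<times> W)) = card U * card U"
    using UW(4) by (simp add: card_image card_cartesian_product)
  moreover have "(\<lambda>(u, w). {u, w}) ` (U \<times> W) \<subseteq> meet U \<inter> meet W"
    using bi by (auto simp: meet_def)
  ultimately have "card U * card U \<le> card (meet U \<inter> meet W)"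
    using card_mono[of "meet U \<inter> meet W"] finm by (metis finite_Int)
  moreover have "?J = meet U \<union> meet W" using cover by (auto simp: meet_def)
  then have "card ?J + card (meet U \<inter> meet W) = card (meet U) + card (meet W)"
    using card_Un_Int[OF finm finm] by metis
  ultimately have "card ?J + (card U)\<^sup>2 \<le> 2 * card U * k"
    using meet_le[OF UW(1)] meet_le[OF UW(2)] UW(4) by (simp add: power2_eq_square)
  moreover have "card U < m"
  proof (rule ccontr)
    assume "\<not> card U < m"
    then have "has_biclique m H"
      using UW bi sub H(1) by (intro has_biclique_mono[of U H W]) auto
    then show False using no by blast
  qed
  ultimately show ?thesis using that by blast
qed

section \<open>Degrees, complements and the boxicity bound\<close>

lemma sum_vdegree:
  assumes "simple_graph G"
  shows "(\<Sum>v\<in>verts G. vdegree G v) = 2 * card (edges G)"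
proof -
  have fin: "finite (verts G)" "finite (edges G)"
    using assms finite_all_edges finite_subset by (auto simp: simple_graph_def)
  have "card {v \<in> verts G. v \<in> e} = 2" if "e \<in> edges G" for e
  proof -
    have "e \<subseteq> verts G" "card e = 2" using that assms by (auto simp: simple_graph_def all_edges_def)
    then show ?thesis by (simp add: Collect_conj_eq Int_absorb1)
  qed
  then show ?thesis
    unfolding vdegree_def using sum_multicount[OF fin, of "\<lambda>v e. v \<in> e" 2] by simp
qed

lemma simple_graph_complement: "simple_graph G \<Longrightarrow> simple_graph (graph_complement G)"
  by (auto simp: simple_graph_def graph_complement_def)

lemma graph_complement_complement: "simple_graph G \<Longrightarrow> graph_complement (graph_complement G) = G"
  by (simp add: simple_graph_def graph_complement_def double_diff)

lemma vdegree_complement: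
  assumes "simple_graph G" "v \<in> verts G"
  shows "vdegree G v + vdegree (graph_complement G) v = card (verts G) - 1"
proof -
  let ?D = "\<lambda>E. {e \<in> E. v \<in> e}" and ?A = "all_edges (verts G)"
  have fin: "finite (verts G)" and sub: "edges G \<subseteq> ?A"
    using assms by (auto simp: simple_graph_def)
  have "?D ?A = (\<lambda>u. {v, u}) ` (verts G - {v})"
    using assms(2) by (auto simp: pair_in_all_edges elim!: all_edgesE)
  moreover have "inj_on (\<lambda>u. {v, u}) (verts G - {v})"
    by (auto simp: inj_on_def doubleton_eq_iff)
  ultimately have "card (?D ?A) = card (verts G) - 1"
    using assms(2) fin by (simp add: card_image)
  moreover have "?D ?A = ?D (edges G) \<union> ?D (?A - edges G)" using sub by auto
  moreover have "finite ?A" "finite (edges G)"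
    using finite_subset[OF sub] finite_all_edges[OF fin] by auto
  then have "card (?D (edges G) \<union> ?D (?A - edges G)) = card (?D (edges G)) + card (?D (?A - edges G))"
    by (intro card_Un_disjoint) auto
  ultimately show ?thesis by (simp add: vdegree_def graph_complement_def)
qed

text \<open>\<open>M\<close> bounds the non-edges of a single interval graph, being at least
  \<open>2 * j * k - j\<^sup>2\<close> for every admissible \<open>j\<close>. The
  \<open>boxicity G\<close> sets of non-edges cover the edges of the complement, and twice the
  number of these is \<open>card (verts G) * k\<close>.\<close>

lemma boxicity_complement_regular:
  assumes G: "simple_graph G" and reg: "regular_graph k (graph_complement G)"
    and no: "\<not> has_biclique m (graph_complement G)"
    and M: "\<And>j. j < m \<Longrightarrow> 2 * j * k \<le> M + j\<^sup>2"
  shows "card (verts G) * k \<le> 2 * (boxicity G * M)"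
proof -
  let ?V = "verts G" and ?H = "graph_complement G"
  have "box_representable (boxicity G) G"
    unfolding boxicity_def using box_representable_exists[OF G] by (rule LeastI_ex)
  then obtain I where I: "\<And>i. i < boxicity G \<Longrightarrow> interval_graph (I i) \<and> verts (I i) = ?V"
    and E: "edges G = all_edges ?V \<inter> (\<Inter>i<boxicity G. edges (I i))"
    unfolding box_representable_def by blast
  define J where "J i = all_edges ?V - edges (I i)" for i
  \<comment> \<open>By De Morgan, an edge of \<open>?H\<close> is missing from some
    \<open>I i\<close>.\<close>
  have J: "edges ?H = (\<Union>i<boxicity G. J i)"
    by (auto simp: E J_def graph_complement_def)
  have "card (J i) \<le> M" if i: "i < boxicity G" for i
  proof -
    have "J i \<subseteq> edges ?H" using J i by blast
    then obtain j where "j < m" "card (J i) + j\<^sup>2 \<le> 2 * j * k"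
      using card_interval_graph_nonedges[of "I i" ?H k m] I[OF i] reg no
      by (auto simp: J_def graph_complement_def regular_graph_def)
    then show ?thesis using M[of j] by simp
  qed
  then have "(\<Sum>i<boxicity G. card (J i)) \<le> boxicity G * M"
    using sum_bounded_above[of "{..<boxicity G}" "\<lambda>i. card (J i)" M] by simp
  moreover have "card (edges ?H) \<le> (\<Sum>i<boxicity G. card (J i))"
    unfolding J by (rule card_UN_le) simp
  moreover have "card ?V * k = 2 * card (edges ?H)"
    using sum_vdegree[OF simple_graph_complement[OF G]] reg
    by (simp add: regular_graph_def graph_complement_def)
  ultimately show ?thesis by simp
qed

section \<open>Four-cycles and the cycle graph\<close>

lemma has_biclique_2E:
  assumes "has_biclique 2 G"
  obtains a b c d where "{a, b} \<subseteq> verts G" "{c, d} \<subseteq> verts G" "{a, b} \<inter> {c, d} = {}"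
    "a \<noteq> b" "c \<noteq> d" "\<forall>u\<in>{a, b}. \<forall>w\<in>{c, d}. {u, w} \<in> edges G"
proof -
  obtain U W where UW: "U \<subseteq> verts G" "W \<subseteq> verts G" "U \<inter> W = {}" "card U = 2" "card W = 2"
    "\<forall>u\<in>U. \<forall>w\<in>W. {u, w} \<in> edges G"
    using assms unfolding has_biclique_def by (elim exE conjE) (rule that)
  obtain a b where ab: "U = {a, b}" "a \<noteq> b" using UW(4) by (auto simp: card_2_iff)
  obtain c d where cd: "W = {c, d}" "c \<noteq> d" using UW(5) by (auto simp: card_2_iff)
  show thesis by (rule that[OF UW(1)[unfolded ab] UW(2)[unfolded cd] UW(3)[unfolded ab cd]
      ab(2) cd(2) UW(6)[unfolded ab cd]])
qed

lemma biclique_2_imp_C4: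
  assumes "has_biclique 2 G"
  shows "contains_subgraph G (cycle_graph 4)"
proof -
  obtain a b c d where abcd: "{a, b} \<subseteq> verts G" "{c, d} \<subseteq> verts G" "{a, b} \<inter> {c, d} = {}"
    "a \<noteq> b" "c \<noteq> d" and E: "\<forall>u\<in>{a, b}. \<forall>w\<in>{c, d}. {u, w} \<in> edges G"
    using assms by (rule has_biclique_2E)
  \<comment> \<open>Walking round the 4-cycle alternates between the sides \<open>{a, b}\<close> and
    \<open>{c, d}\<close>.\<close>
  define f where "f = (!) [a, c, b, d]"
  have f: "f 0 = a" "f 1 = c" "f 2 = b" "f 3 = d" by (simp_all add: f_def)
  have V: "verts (cycle_graph 4) = {0, 1, 2, 3}" by (auto simp: cycle_graph_def)
  have "f ` e \<in> edges G" if "e \<in> edges (cycle_graph 4)" for e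
  proof -
    obtain i :: nat where "i < 4" "e = {i, (i + 1) mod 4}"
      using \<open>e \<in> edges (cycle_graph 4)\<close> by (auto simp: cycle_graph_def)
    moreover have "i = 0 \<or> i = 1 \<or> i = 2 \<or> i = 3" using \<open>i < 4\<close> by linarith
    ultimately show ?thesis
      using E by (elim disjE) (simp_all add: f insert_commute del: One_nat_def)
  qed
  moreover have "inj_on f (verts (cycle_graph 4))"
    unfolding V using abcd by (auto simp: inj_on_def f simp del: One_nat_def)
  moreover have "f ` verts (cycle_graph 4) \<subseteq> verts G"
    unfolding V using abcd by (simp add: f del: One_nat_def)
  ultimately show ?thesis unfolding contains_subgraph_def by blast
qed

lemma simple_cycle_graph: "n \<ge> 2 \<Longrightarrow> simple_graph (cycle_graph n)"
proof -
  assume "n \<ge> 2"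
  then have "{i, (i + 1) mod n} \<in> all_edges {0..<n}" if "i < n" for i
    using that unfolding pair_in_all_edges by (auto simp: mod_Suc)
  then show ?thesis by (auto simp: simple_graph_def cycle_graph_def)
qed

lemma cycle_graph_edge_iff:
  "{u, v} \<in> edges (cycle_graph n) \<longleftrightarrow>
     u < n \<and> v < n \<and> (v = (u + 1) mod n \<or> u = (v + 1) mod n)"
  by (auto simp: cycle_graph_def doubleton_eq_iff)

lemma regular_cycle_graph:
  assumes "n \<ge> 3"
  shows "regular_graph 2 (cycle_graph n)"
proof -
  have "card {e \<in> edges (cycle_graph n). v \<in> e} = 2" if "v < n" for v
  proof -
    define p where "p = (if v = 0 then n - 1 else v - 1)"
    define s where "s = (v + 1) mod n"
    \<comment> \<open>\<open>n \<ge> 3\<close> keeps successor and predecessor apart; for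
      \<open>n = 2\<close> the two edges at \<open>v\<close> would coincide.\<close>
    have p: "p < n" "(p + 1) mod n = v" and "s \<noteq> p" "p \<noteq> v"
      using that assms by (auto simp: p_def s_def mod_Suc)
    have p_unique: "i = p" if "i < n" "(i + 1) mod n = v" for i
      using that by (simp add: p_def mod_Suc split: if_splits)
    have "{e \<in> edges (cycle_graph n). v \<in> e} =
        (\<lambda>i. {i, (i + 1) mod n}) ` {i. i < n \<and> (i = v \<or> (i + 1) mod n = v)}"
      by (auto simp: cycle_graph_def)
    also have "{i. i < n \<and> (i = v \<or> (i + 1) mod n = v)} = {v, p}"
      using that p p_unique by blast
    also have "(\<lambda>i. {i, (i + 1) mod n}) ` {v, p} = {{v, s}, {p, v}}"
      using p(2) by (simp add: s_def)
    finally have "{e \<in> edges (cycle_graph n). v \<in> e} = {{v, s}, {p, v}}" .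
    moreover have "{v, s} \<noteq> {p, v}"
      using \<open>s \<noteq> p\<close> \<open>p \<noteq> v\<close> by (auto simp: doubleton_eq_iff)
    ultimately show ?thesis by simp
  qed
  then show ?thesis by (simp add: regular_graph_def vdegree_def cycle_graph_def)
qed

text \<open>Every edge joins a vertex to its successor. As the successor map is injective, the four
  edges of a \<open>K\<^sub>2\<^sub>,\<^sub>2\<close> all run the same way round, so four steps
  return to the start and \<open>n\<close> would divide 4.\<close>

lemma cycle_graph_no_biclique:
  assumes "n \<ge> 3" "n \<noteq> 4"
  shows "\<not> has_biclique 2 (cycle_graph n)"
proof
  assume bi: "has_biclique 2 (cycle_graph n)"
  obtain a b c d where abcd: "{a, b} \<inter> {c, d} = {}" "a \<noteq> b" "c \<noteq> d"
    and E: "\<forall>u\<in>{a, b}. \<forall>w\<in>{c, d}. {u, w} \<in> edges (cycle_graph n)"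
    by (rule has_biclique_2E[OF bi])
  \<comment> \<open>A case distinction in place of \<open>mod n\<close> makes the claim about four
    steps linear.\<close>
  define s where "s u = (if u = n - 1 then 0 else u + 1)" for u
  have "(v = s u \<or> u = s v) \<and> u < n \<and> v < n" if "{u, v} \<in> edges (cycle_graph n)" for u v
    using that unfolding cycle_graph_edge_iff by (auto simp: s_def mod_Suc split: if_splits)
  then have adj: "c = s a \<or> a = s c" "d = s a \<or> a = s d" "c = s b \<or> b = s c" "d = s b \<or> b = s d"
    and lt: "a < n" "b < n" "c < n" "d < n"
    using E by blast+
  have inj: "u = v" if "s u = s v" "u < n" "v < n" for u v
    using that by (auto simp: s_def split: if_splits)
  have four: "s (s (s (s u))) \<noteq> u" if "u < n" for u
    using that assms unfolding s_def by presburger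
  have ne: "c \<noteq> a" "c \<noteq> b" "d \<noteq> a" "d \<noteq> b" using abcd(1) by auto
  have sd: "s c \<noteq> s d" "s a \<noteq> s b" using inj lt abcd by metis+
  \<comment> \<open>The direction of the edge between \<open>a\<close> and \<open>c\<close>
    determines that of the other three.\<close>
  from adj(1) show False
  proof
    assume c: "c = s a"
    have ad: "a = s d" using adj(2) c abcd(3) by metis
    have bc: "b = s c" using adj(3) c sd(2) by metis
    have "d = s b" using adj(4) ad abcd(2) by metis
    then show False using four[OF lt(1)] c ad bc by metis
  next
    assume a: "a = s c"
    have da: "d = s a" using adj(2) a sd(1) by metis
    have cb: "c = s b" using adj(3) a abcd(2) by metis
    have "b = s d" using adj(4) da sd(2) by metis
    then show False using four[OF lt(1)] a da cb by metis
  qed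
qed

theorem theorem4:
  fixes k n :: nat
  assumes "k \<ge> 1" and "n \<ge> 1"
  shows "(\<forall>G :: 'a ugraph. simple_graph G \<and> card (verts G) = n \<and>
             k + 1 \<le> n \<and> regular_graph (n - k - 1) G \<and> planar (graph_complement G)
           \<longrightarrow> real (boxicity G) \<ge> real n / 8) \<and>
         (\<forall>G :: 'a ugraph. simple_graph G \<and> card (verts G) = n \<and>
             regular_graph k (graph_complement G) \<and>
             \<not> contains_subgraph (graph_complement G) (cycle_graph 4)
           \<longrightarrow> real (boxicity G) \<ge> real n / 4) \<and>
         (n \<ge> 3 \<and> n \<noteq> 4 \<longrightarrow> real (boxicity (graph_complement (cycle_graph n))) \<ge> real n / 3)"
proof (intro conjI allI impI; (elim conjE)?)
  fix G :: "'a ugraph"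
  assume G: "simple_graph G" "card (verts G) = n" "k + 1 \<le> n"
    and reg: "regular_graph (n - k - 1) G" and pl: "planar (graph_complement G)"
  \<comment> \<open>The degree is \<open>(n - 1) - (n - k - 1) = k\<close>, where
    \<open>k + 1 \<le> n\<close> keeps the subtraction from being truncated.\<close>
  have "vdegree (graph_complement G) v = k" if "v \<in> verts G" for v
    using vdegree_complement[OF G(1) that] reg G(2,3) that by (simp add: regular_graph_def)
  then have "regular_graph k (graph_complement G)"
    by (simp add: regular_graph_def graph_complement_def)
  moreover have "\<not> has_biclique 3 (graph_complement G)"
    using planar_no_K33[OF pl] unfolding has_biclique_def by metis
  \<comment> \<open>For \<open>j \<le> 2\<close> the choice \<open>M = 4 * k\<close> works, and its
    factor \<open>k\<close> cancels below.\<close>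
  ultimately have "n * k \<le> 2 * (boxicity G * (4 * k))"
    unfolding G(2)[symmetric] using G(1)
    by (rule_tac boxicity_complement_regular) (auto simp: less_Suc_eq numeral_3_eq_3)
  then have "n * k \<le> (8 * boxicity G) * k" by (simp add: ac_simps)
  then have "n \<le> 8 * boxicity G" using assms(1) by simp
  then show "real n / 8 \<le> real (boxicity G)" by linarith
next
  fix G :: "'a ugraph"
  assume G: "simple_graph G" "card (verts G) = n"
    and reg: "regular_graph k (graph_complement G)"
    and "\<not> contains_subgraph (graph_complement G) (cycle_graph 4)"
  then have "\<not> has_biclique 2 (graph_complement G)"
    using biclique_2_imp_C4 by blast
  \<comment> \<open>Only \<open>j \<le> 1\<close> is left, so \<open>M = 2 * k\<close>
    works.\<close>
  then have "n * k \<le> 2 * (boxicity G * (2 * k))"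
    unfolding G(2)[symmetric] using G(1) reg
    by (rule_tac boxicity_complement_regular) (auto simp: less_Suc_eq numeral_2_eq_2)
  then have "n * k \<le> (4 * boxicity G) * k" by (simp add: ac_simps)
  then have "n \<le> 4 * boxicity G" using assms(1) by simp
  then show "real n / 4 \<le> real (boxicity G)" by linarith
next
  assume n: "n \<ge> 3" "n \<noteq> 4"
  let ?G = "graph_complement (cycle_graph n)"
  have C: "simple_graph (cycle_graph n)" using n(1) by (intro simple_cycle_graph) simp
  \<comment> \<open>With \<open>k = 2\<close> and \<open>j \<le> 1\<close> the exact value
    \<open>2 * k - 1 = 3\<close> serves as \<open>M\<close>, which improves \<open>n / 4\<close> to
    \<open>n / 3\<close>.\<close>
  have "card (verts ?G) * 2 \<le> 2 * (boxicity ?G * 3)"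
  proof (rule boxicity_complement_regular[where m = 2])
    show "2 * j * 2 \<le> 3 + j\<^sup>2" if "j < 2" for j :: nat
      using that by (auto simp: less_Suc_eq numeral_2_eq_2)
  qed (use C n in \<open>simp_all add: simple_graph_complement graph_complement_complement
        regular_cycle_graph cycle_graph_no_biclique\<close>)
  then have "n \<le> 3 * boxicity ?G" by (simp add: graph_complement_def cycle_graph_def)
  then show "real n / 3 \<le> real (boxicity ?G)" by linarith
qed

end
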